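(* If $G$ is a SIN totally disconnected locally compact group and $K$ is any normal compact open subgroup of $G$, then $M(G)$ is isomorphic to $M(G/K)\times K$.
   Context: A topological group $G$ with neutral element $e$ is SIN if its left uniformity (generated by the covers $\{gV:g\in G\}$) and right uniformity (generated by the covers $\{Vg:g\in G\}$), $V$ ranging over open neighbourhoods of $e$, coincide. A $G$-flow is a continuous left action $G\times X\to X$ on a compact Hausdorff space $X$. A homomorphism of $G$-flows is a continuous $G$-equivariant map; an isomorphism is a bijective homomorphism. A $G$-flow is minimal if every orbit is dense. The universal minimal flow $M(G)$ is the minimal $G$-flow, unique up to isomorphism, that admits a homomorphism onto every minimal $G$-flow; $M(G/K)$ is the universal minimal flow of the (discrete) group $G/K$. Isomorphic means isomorphic as $G$-flows, for some action of $G$ on $M(G/K)\times K$; the statement does not specify this action. *)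

theory Defs
  imports "HOL-Analysis.Analysis" "HOL-Algebra.Group_Action"
begin

section \<open>Topological groups\<close>

locale topological_group = group G
  for G (structure) and T :: "'g topology" +
  assumes topspace_eq: "topspace T = carrier G"
    and continuous_mult: "continuous_map (prod_topology T T) T (\<lambda>(x, y). x \<otimes> y)"
    and continuous_inv: "continuous_map T T (\<lambda>x. inv x)"

definition totally_disconnected_space :: "'a topology \<Rightarrow> bool" where
  "totally_disconnected_space X \<longleftrightarrow>
     (\<forall>x \<in> topspace X. connected_component_of_set X x = {x})"

text \<open>
  Uniformities are given by their families of uniform covers. Since the cover by the sets
  \<open>g(V \<inter> W)\<close> refines both the cover by the sets \<open>gV\<close> and the cover by the sets \<open>gW\<close>, the
  basic covers are directed under refinement, and the uniformity they generate consists of all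
  covers that are refined by a basic one. No separation axiom is built into
  \<open>topological_group\<close>; a totally disconnected topological group is automatically Hausdorff.
\<close>

definition cover_of :: "'a set \<Rightarrow> 'a set set \<Rightarrow> bool" where
  "cover_of S \<C> \<longleftrightarrow> \<C> \<subseteq> Pow S \<and> \<Union>\<C> = S"

definition refines :: "'a set set \<Rightarrow> 'a set set \<Rightarrow> bool" where
  "refines \<B> \<C> \<longleftrightarrow> (\<forall>B \<in> \<B>. \<exists>C \<in> \<C>. B \<subseteq> C)"

definition left_uniformity :: "('g, 'b) monoid_scheme \<Rightarrow> 'g topology \<Rightarrow> 'g set set set" where
  "left_uniformity G T =
     {\<C>. cover_of (carrier G) \<C> \<and>
         (\<exists>V. openin T V \<and> \<one>\<^bsub>G\<^esub> \<in> V \<and> refines ((\<lambda>g. g <#\<^bsub>G\<^esub> V) ` carrier G) \<C>)}"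

definition right_uniformity :: "('g, 'b) monoid_scheme \<Rightarrow> 'g topology \<Rightarrow> 'g set set set" where
  "right_uniformity G T =
     {\<C>. cover_of (carrier G) \<C> \<and>
         (\<exists>V. openin T V \<and> \<one>\<^bsub>G\<^esub> \<in> V \<and> refines ((\<lambda>g. V #>\<^bsub>G\<^esub> g) ` carrier G) \<C>)}"

definition SIN :: "('g, 'b) monoid_scheme \<Rightarrow> 'g topology \<Rightarrow> bool" where
  "SIN G T \<longleftrightarrow> left_uniformity G T = right_uniformity G T"


section \<open>Flows\<close>

text \<open>
  The locale \<open>group_action\<close> forces \<open>act g\<close>, for \<open>g\<close> in the group, to be \<open>undefined\<close> outside
  \<open>topspace X\<close>; this only normalizes irrelevant values.
\<close>

definition flow ::
  "('g, 'b) monoid_scheme \<Rightarrow> 'g topology \<Rightarrow> 'x topology \<Rightarrow> ('g \<Rightarrow> 'x \<Rightarrow> 'x) \<Rightarrow> bool" where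
  "flow G T X act \<longleftrightarrow>
     compact_space X \<and> Hausdorff_space X \<and>
     group_action G (topspace X) act \<and>
     continuous_map (prod_topology T X) X (\<lambda>(g, x). act g x)"

definition flow_hom ::
  "('g, 'b) monoid_scheme \<Rightarrow> 'x topology \<Rightarrow> ('g \<Rightarrow> 'x \<Rightarrow> 'x) \<Rightarrow>
   'y topology \<Rightarrow> ('g \<Rightarrow> 'y \<Rightarrow> 'y) \<Rightarrow> ('x \<Rightarrow> 'y) \<Rightarrow> bool" where
  "flow_hom G X actX Y actY f \<longleftrightarrow>
     continuous_map X Y f \<and>
     (\<forall>g \<in> carrier G. \<forall>x \<in> topspace X. f (actX g x) = actY g (f x))"

definition flow_iso ::
  "('g, 'b) monoid_scheme \<Rightarrow> 'x topology \<Rightarrow> ('g \<Rightarrow> 'x \<Rightarrow> 'x) \<Rightarrow>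
   'y topology \<Rightarrow> ('g \<Rightarrow> 'y \<Rightarrow> 'y) \<Rightarrow> ('x \<Rightarrow> 'y) \<Rightarrow> bool" where
  "flow_iso G X actX Y actY f \<longleftrightarrow>
     flow_hom G X actX Y actY f \<and> bij_betw f (topspace X) (topspace Y)"

text \<open>
  Minimal flows are nonempty, as usual; otherwise the empty flow would be minimal and no
  nonempty flow could map onto it.
\<close>

definition minimal_flow ::
  "('g, 'b) monoid_scheme \<Rightarrow> 'g topology \<Rightarrow> 'x topology \<Rightarrow> ('g \<Rightarrow> 'x \<Rightarrow> 'x) \<Rightarrow> bool" where
  "minimal_flow G T X act \<longleftrightarrow>
     flow G T X act \<and> topspace X \<noteq> {} \<and>
     (\<forall>x \<in> topspace X. X closure_of (orbit G act x) = topspace X)"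

text \<open>
  The quantification over all minimal \<open>G\<close>-flows is expressed by the flows whose underlying
  set lies in the type \<open>'g set set\<close>. This loses nothing: if \<open>D\<close> is an orbit of a minimal flow
  \<open>Y\<close>, then \<open>y \<mapsto> {A \<inter> D | A. A neighbourhood of y}\<close> is injective, because \<open>D\<close> is dense and
  \<open>Y\<close> is Hausdorff, and \<open>D\<close> is an image of \<open>carrier G\<close>; hence \<open>Y\<close> has an isomorphic copy with
  underlying set in \<open>'g set set\<close>.
\<close>

definition universal_minimal_flow ::
  "('g, 'b) monoid_scheme \<Rightarrow> 'g topology \<Rightarrow> 'x topology \<Rightarrow> ('g \<Rightarrow> 'x \<Rightarrow> 'x) \<Rightarrow> bool" where
  "universal_minimal_flow G T X act \<longleftrightarrow>
     minimal_flow G T X act \<and>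
     (\<forall>(Y :: 'g set set topology) actY. minimal_flow G T Y actY \<longrightarrow>
        (\<exists>f. flow_hom G X act Y actY f \<and> f ` topspace X = topspace Y))"

end

theory Submission
  imports Defs
begin

text \<open>
  Since the action on the product may be chosen freely, an action transported along a
  homeomorphism will do, and it suffices to find a homeomorphism between \<open>M\<close> and \<open>N \<times> K\<close>.

  The first half trivialises the action of \<open>K\<close> on \<open>M\<close>. The maps \<open>\<omega> : G \<rightarrow> K\<close> with
  \<open>\<omega>(kh) = k\<omega>(h)\<close> for \<open>k \<in> K\<close> form a nonempty closed subset of the compact space \<open>K\<^sup>G\<close>, and
  \<open>G\<close> acts on it by \<open>(g\<omega>)(h) = \<omega>(hg)\<close>. As \<open>K\<close> is open and normal this action is jointly
  continuous, so \<open>M\<close> maps to a minimal subflow. Evaluation at the neutral element turns this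
  homomorphism into a continuous \<open>F : M \<rightarrow> K\<close> with \<open>F(kx) = kF(x)\<close>
  (\<open>equivariant_map_to_K\<close>). Hence the slice \<open>C = F\<inverse>(1)\<close> meets every \<open>K\<close>-orbit exactly once,
  \<open>(c, k) \<mapsto> kc\<close> is a homeomorphism \<open>C \<times> K \<rightarrow> M\<close> (\<open>slice_times_K_homeomorphic\<close>), and \<open>C\<close> is a
  model of the orbit space \<open>M/K\<close>. In particular \<open>C\<close> is a minimal flow of \<open>G/K\<close>.

  The second half identifies \<open>C\<close> with \<open>N\<close>. Regarded as a flow of \<open>G\<close>, the space \<open>N\<close> is
  minimal, so there is a homomorphism \<open>M \<rightarrow> N\<close>; as \<open>K\<close> acts trivially on \<open>N\<close>, it restricts to a
  homomorphism \<open>C \<rightarrow> N\<close> of \<open>G/K\<close>-flows. A minimal flow that maps to a universal minimal flow is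
  isomorphic to it (\<open>minimal_flow_over_universal_iso\<close>), because every endomorphism of a
  universal minimal flow \<open>X\<close> is injective. The latter is Ellis's argument: in a minimal left
  ideal \<open>L\<close> of the enveloping semigroup, the closure of \<open>G\<close> in \<open>X\<^sup>X\<close>, an idempotent provides
  enough invertibility to make all endomorphisms of the flow \<open>L\<close> injective; and an endomorphism
  \<open>\<phi>\<close> of \<open>X\<close> fits into an endomorphism \<open>L \<rightarrow> X \<rightarrow> X \<rightarrow> L\<close> of \<open>L\<close>, whose first map is onto.
\<close>

section \<open>Compact right topological semigroups\<close>

text \<open>
  Zorn's lemma; the intersection of a chain of nonempty closed sets is nonempty by compactness.
  Below \<open>P\<close> is "subsemigroup" or "invariant".
\<close>
lemma minimal_closed_set:
  assumes X: "compact_space X" and A0: "closedin X A0" "A0 \<noteq> {}" "P A0"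
    and Inter: "\<And>\<C>. \<C> \<noteq> {} \<Longrightarrow> \<forall>A\<in>\<C>. P A \<Longrightarrow> P (\<Inter>\<C>)"
  shows "\<exists>A. closedin X A \<and> A \<noteq> {} \<and> P A \<and> A \<subseteq> A0 \<and>
    (\<forall>B. closedin X B \<and> B \<noteq> {} \<and> P B \<and> B \<subseteq> A \<longrightarrow> B = A)"
proof -
  define \<A> where "\<A> = {A. closedin X A \<and> A \<noteq> {} \<and> P A \<and> A \<subseteq> A0}"
  have sub: "A \<subseteq> topspace X" if "A \<in> \<A>" for A
    using that by (auto simp: \<A>_def dest: closedin_subset)
  have "\<exists>M\<in>(\<lambda>A. topspace X - A) ` \<A>. \<forall>U\<in>(\<lambda>A. topspace X - A) ` \<A>. M \<subseteq> U \<longrightarrow> U = M"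
  proof (rule subset_Zorn_nonempty)
    show "(\<lambda>A. topspace X - A) ` \<A> \<noteq> {}"
      using A0 by (auto simp: \<A>_def)
  next
    fix \<U> assume ne: "\<U> \<noteq> {}" and ch: "subset.chain ((\<lambda>A. topspace X - A) ` \<A>) \<U>"
    define \<C> where "\<C> = (\<lambda>U. topspace X - U) ` \<U>"
    have \<U>: "U \<in> (\<lambda>A. topspace X - A) ` \<A>" if "U \<in> \<U>" for U
      using ch that unfolding subset.chain_def by blast
    have \<C>: "\<C> \<subseteq> \<A>"
    proof
      fix A assume "A \<in> \<C>"
      then obtain U where "U \<in> \<U>" "A = topspace X - U" by (auto simp: \<C>_def)
      with \<U> obtain B where "B \<in> \<A>" "A = topspace X - (topspace X - B)" by blast
      with sub show "A \<in> \<A>" by (simp add: double_diff)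
    qed
    have ne': "\<C> \<noteq> {}" using ne by (simp add: \<C>_def)
    have chain: "subset.chain UNIV \<C>"
      unfolding subset_chain_def
    proof (intro conjI ballI)
      fix A B assume "A \<in> \<C>" "B \<in> \<C>"
      then obtain U V where "U \<in> \<U>" "V \<in> \<U>" "A = topspace X - U" "B = topspace X - V"
        by (auto simp: \<C>_def)
      moreover from this have "U \<subseteq> V \<or> V \<subseteq> U" using ch by (simp add: subset_chain_def)
      ultimately show "A \<subseteq> B \<or> B \<subseteq> A" by (metis Diff_mono order_refl)
    qed simp
    have "\<Inter>\<F> \<noteq> {}" if "finite \<F>" "\<F> \<subseteq> \<C>" for \<F>
    proof (cases "\<F> = {}")
      case False
      have "subset.chain UNIV \<F>"
        using chain that(2) by (meson subset_chain_def subset_UNIV subsetD)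
      then have "\<Inter>\<F> \<in> \<F>"
        using that(1) False Inter_in_chain by blast
      then show ?thesis using that(2) \<C> by (auto simp: \<A>_def)
    qed auto
    moreover have "\<forall>A\<in>\<C>. closedin X A" using \<C> by (auto simp: \<A>_def)
    ultimately have "\<Inter>\<C> \<noteq> {}"
      using X by (simp add: compact_space_fip)
    moreover have "closedin X (\<Inter>\<C>)" using ne' \<C> by (auto simp: \<A>_def)
    moreover have "P (\<Inter>\<C>)" using Inter ne' \<C> by (auto simp: \<A>_def)
    moreover have "\<Inter>\<C> \<subseteq> A0" using ne' \<C> by (auto simp: \<A>_def)
    ultimately have "\<Inter>\<C> \<in> \<A>" by (simp add: \<A>_def)
    moreover have "\<Union>\<U> = topspace X - \<Inter>\<C>"
      using \<U> by (auto simp: \<C>_def)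
    ultimately show "\<Union>\<U> \<in> (\<lambda>A. topspace X - A) ` \<A>" by blast
  qed
  then obtain A where A: "A \<in> \<A>"
    and max: "\<And>B. B \<in> \<A> \<Longrightarrow> topspace X - A \<subseteq> topspace X - B \<Longrightarrow> topspace X - B = topspace X - A"
    by blast
  have "B = A" if "closedin X B" "B \<noteq> {}" "P B" "B \<subseteq> A" for B
  proof -
    have "B \<in> \<A>" using that A by (auto simp: \<A>_def)
    with max[of B] \<open>B \<subseteq> A\<close> have "topspace X - B = topspace X - A" by blast
    with sub[OF A] sub[OF \<open>B \<in> \<A>\<close>] show "B = A" by blast
  qed
  then show ?thesis using A by (intro exI[of _ A]) (auto simp: \<A>_def)
qed

lemma compact_image_closedin:
  assumes "compact_space X" "Hausdorff_space Y" "continuous_map X Y f" "closedin X A"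
  shows "closedin Y (f ` A)"
  using assms by (meson closedin_compact_space compactin_imp_closedin image_compactin)

text \<open>
  Ellis and Numakura. In a minimal closed subsemigroup \<open>A\<close> with an element \<open>u\<close>, the closed
  subsemigroups \<open>Au\<close> and then \<open>{a \<in> A. au = u}\<close> must be all of \<open>A\<close>, so \<open>u\<close> itself satisfies
  \<open>uu = u\<close>.
\<close>
lemma compact_right_topological_semigroup_idempotent:
  assumes X: "compact_space X" "Hausdorff_space X" "topspace X \<noteq> {}"
    and closed: "\<And>a b. a \<in> topspace X \<Longrightarrow> b \<in> topspace X \<Longrightarrow> mul a b \<in> topspace X"
    and assoc: "\<And>a b c. a \<in> topspace X \<Longrightarrow> b \<in> topspace X \<Longrightarrow> c \<in> topspace X \<Longrightarrow>
      mul (mul a b) c = mul a (mul b c)"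
    and cont: "\<And>b. b \<in> topspace X \<Longrightarrow> continuous_map X X (\<lambda>a. mul a b)"
  shows "\<exists>u\<in>topspace X. mul u u = u"
proof -
  obtain A where A: "closedin X A" "A \<noteq> {}" "\<forall>a\<in>A. \<forall>b\<in>A. mul a b \<in> A"
    and min: "\<And>B. closedin X B \<Longrightarrow> B \<noteq> {} \<Longrightarrow> \<forall>a\<in>B. \<forall>b\<in>B. mul a b \<in> B \<Longrightarrow> B \<subseteq> A \<Longrightarrow> B = A"
    using minimal_closed_set[OF X(1) closedin_topspace X(3),
        where P = "\<lambda>A. \<forall>a\<in>A. \<forall>b\<in>A. mul a b \<in> A"] closed
    by (smt (verit) InterE InterI)
  have AX: "A \<subseteq> topspace X" using A(1) by (rule closedin_subset)
  obtain u where u: "u \<in> A" using A(2) by blast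
  have "(\<lambda>a. mul a u) ` A = A"
  proof (rule min)
    show "closedin X ((\<lambda>a. mul a u) ` A)"
      using X cont A(1) AX u by (intro compact_image_closedin) auto
    show "\<forall>a\<in>(\<lambda>a. mul a u) ` A. \<forall>b\<in>(\<lambda>a. mul a u) ` A. mul a b \<in> (\<lambda>a. mul a u) ` A"
    proof clarify
      fix a b assume ab: "a \<in> A" "b \<in> A"
      have "mul (mul a u) (mul b u) = mul (mul (mul a u) b) u"
        using ab u A(3) AX by (subst assoc) auto
      then show "mul (mul a u) (mul b u) \<in> (\<lambda>a. mul a u) ` A"
        using ab u A(3) by blast
    qed
  qed (use A u in auto)
  then have ex: "\<exists>a\<in>A. mul a u = u" using u by (metis imageE)
  have "{a \<in> A. mul a u = u} = A"
  proof (rule min)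
    have "{a \<in> A. mul a u = u} = A \<inter> {a \<in> topspace X. mul a u = u}" using AX by auto
    moreover have "closedin X {a \<in> topspace X. mul a u = u}"
      using X cont AX u by (intro closedin_continuous_maps_eq) auto
    ultimately show "closedin X {a \<in> A. mul a u = u}" using A(1) by auto
    show "\<forall>a\<in>{a \<in> A. mul a u = u}. \<forall>b\<in>{a \<in> A. mul a u = u}. mul a b \<in> {a \<in> A. mul a u = u}"
    proof clarify
      fix a b assume "a \<in> A" "b \<in> A" "mul a u = u" "mul b u = u"
      then show "mul a b \<in> A \<and> mul (mul a b) u = u" using A(3) AX u assoc by (simp add: subset_iff)
    qed
  qed (use ex in auto)
  then show ?thesis using u AX by blast
qed

text \<open>
  Left simplicity makes any idempotent \<open>u\<close> a right unit. Therefore \<open>\<psi>\<close> is the right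
  multiplication by \<open>\<psi>(u)\<close>, which has an inverse with respect to \<open>u\<close>; right multiplication by
  that inverse undoes \<open>\<psi>\<close>.
\<close>
lemma left_simple_equivariant_inj:
  assumes X: "compact_space X" "Hausdorff_space X" "topspace X \<noteq> {}"
    and closed: "\<And>a b. a \<in> topspace X \<Longrightarrow> b \<in> topspace X \<Longrightarrow> mul a b \<in> topspace X"
    and assoc: "\<And>a b c. a \<in> topspace X \<Longrightarrow> b \<in> topspace X \<Longrightarrow> c \<in> topspace X \<Longrightarrow>
      mul (mul a b) c = mul a (mul b c)"
    and cont: "\<And>b. b \<in> topspace X \<Longrightarrow> continuous_map X X (\<lambda>a. mul a b)"
    and simple: "\<And>b. b \<in> topspace X \<Longrightarrow> (\<lambda>a. mul a b) ` topspace X = topspace X"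
    and \<psi>: "\<And>a. a \<in> topspace X \<Longrightarrow> \<psi> a \<in> topspace X"
      "\<And>a b. a \<in> topspace X \<Longrightarrow> b \<in> topspace X \<Longrightarrow> \<psi> (mul a b) = mul a (\<psi> b)"
  shows "inj_on \<psi> (topspace X)"
proof -
  have "\<exists>u\<in>topspace X. mul u u = u"
    by (rule compact_right_topological_semigroup_idempotent) (fact X closed assoc cont)+
  then obtain u where u: "u \<in> topspace X" "mul u u = u" by blast
  have right_unit: "mul a u = a" if "a \<in> topspace X" for a
  proof -
    have "a \<in> (\<lambda>a. mul a u) ` topspace X" using simple[OF u(1)] that by simp
    then obtain b where "b \<in> topspace X" "a = mul b u" by blast
    then show ?thesis using assoc u by simp
  qed
  define q where "q = \<psi> u"
  have q: "q \<in> topspace X" "mul u q = q" using \<psi>(1) \<psi>(2)[OF u(1) u(1)] u by (simp_all add: q_def)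
  obtain r where r: "r \<in> topspace X" "mul r q = u" using simple[OF q(1)] u(1) by (metis imageE)
  obtain s where s: "s \<in> topspace X" "mul s r = u" using simple[OF r(1)] u(1) by (metis imageE)
  \<comment> \<open>a left inverse \<open>s\<close> of the left inverse \<open>r\<close> of \<open>q\<close> is \<open>q\<close> itself, so \<open>r\<close> is a two-sided inverse\<close>
  have "q = mul (mul s r) q" using q s by simp
  also have "\<dots> = s" using assoc[OF s(1) r(1) q(1)] r(2) right_unit[OF s(1)] by simp
  finally have qr: "mul q r = u" using s by simp
  show ?thesis
  proof (rule inj_onI)
    fix a b assume ab: "a \<in> topspace X" "b \<in> topspace X" "\<psi> a = \<psi> b"
    have "mul (\<psi> c) r = c" if "c \<in> topspace X" for c
    proof -
      have "\<psi> c = mul c q" using \<psi>(2)[OF that u(1)] right_unit that by (simp add: q_def)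
      then show ?thesis using assoc that q r qr right_unit by simp
    qed
    then show "a = b" using ab by metis
  qed
qed

section \<open>Flows and minimality\<close>

text \<open>
  The common setting for the flows of \<open>G\<close> and those of its discrete quotient.
\<close>
locale topologized_group = group G for G (structure) and T :: "'g topology" +
  assumes topspace_carrier: "topspace T = carrier G"
begin

definition invariant :: "('g \<Rightarrow> 'x \<Rightarrow> 'x) \<Rightarrow> 'x set \<Rightarrow> bool" where
  "invariant act A \<longleftrightarrow> (\<forall>g\<in>carrier G. \<forall>x\<in>A. act g x \<in> A)"

text \<open>
  The action is restricted because the group of bijections of a set consists of functions that
  are \<open>undefined\<close> outside the set.
\<close>
lemma flowI:
  assumes X: "compact_space X" "Hausdorff_space X"
    and closed: "\<And>g x. g \<in> carrier G \<Longrightarrow> x \<in> topspace X \<Longrightarrow> act g x \<in> topspace X"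
    and one: "\<And>x. x \<in> topspace X \<Longrightarrow> act \<one> x = x"
    and mult: "\<And>g h x. g \<in> carrier G \<Longrightarrow> h \<in> carrier G \<Longrightarrow> x \<in> topspace X \<Longrightarrow>
      act (g \<otimes> h) x = act g (act h x)"
    and cont: "continuous_map (prod_topology T X) X (\<lambda>(g, x). act g x)"
  shows "flow G T X (\<lambda>g. restrict (act g) (topspace X))"
proof -
  let ?S = "topspace X"
  have inv: "act (inv g) (act g x) = x" "act g (act (inv g) x) = x"
    if "g \<in> carrier G" "x \<in> ?S" for g x
    using that one mult[of "inv g" g x] mult[of g "inv g" x] by simp_all
  have bij: "restrict (act g) ?S \<in> Bij ?S" if g: "g \<in> carrier G" for g
  proof -
    have "bij_betw (act g) ?S ?S"
      by (rule bij_betwI[where g = "act (inv g)"]) (use closed inv g in auto)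
    then show ?thesis by (simp add: Bij_def)
  qed
  have "group_hom G (BijGroup ?S) (\<lambda>g. restrict (act g) ?S)"
  proof (intro group_hom.intro group_hom_axioms.intro homI)
    fix g h assume gh: "g \<in> carrier G" "h \<in> carrier G"
    have "restrict (act (g \<otimes> h)) ?S = compose ?S (restrict (act g) ?S) (restrict (act h) ?S)"
      using closed mult gh by (auto simp: compose_def)
    then show "restrict (act (g \<otimes> h)) ?S =
        restrict (act g) ?S \<otimes>\<^bsub>BijGroup ?S\<^esub> restrict (act h) ?S"
      using bij gh by (simp add: BijGroup_def)
  qed (use bij group_BijGroup is_group in \<open>auto simp: BijGroup_def\<close>)
  moreover have "continuous_map (prod_topology T X) X (\<lambda>(g, x). restrict (act g) ?S x)"
    using cont by (rule continuous_map_eq) auto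
  ultimately show ?thesis
    using X by (simp add: flow_def group_action_def)
qed

context
  fixes X :: "'x topology" and act
  assumes flow: "flow G T X act"
begin

lemma flow_compact: "compact_space X" and flow_Hausdorff: "Hausdorff_space X"
  and flow_continuous: "continuous_map (prod_topology T X) X (\<lambda>(g, x). act g x)"
  using flow by (auto simp: flow_def)

lemma flow_group_action: "group_action G (topspace X) act"
  using flow by (auto simp: flow_def)

lemma flow_closed: "g \<in> carrier G \<Longrightarrow> x \<in> topspace X \<Longrightarrow> act g x \<in> topspace X"
  using group_action.element_image[OF flow_group_action] by blast

lemma flow_one: "x \<in> topspace X \<Longrightarrow> act \<one> x = x"
  using group_action.id_eq_one[OF flow_group_action] by (metis restrict_apply')

lemma flow_mult:
  "g \<in> carrier G \<Longrightarrow> h \<in> carrier G \<Longrightarrow> x \<in> topspace X \<Longrightarrow> act (g \<otimes> h) x = act g (act h x)"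
  using group_action.composition_rule[OF flow_group_action] by blast

lemma flow_continuous_pair:
  "continuous_map Y T g \<Longrightarrow> continuous_map Y X p \<Longrightarrow> continuous_map Y X (\<lambda>y. act (g y) (p y))"
  using continuous_map_compose[of Y "prod_topology T X" "\<lambda>y. (g y, p y)", OF _ flow_continuous]
  by (simp add: continuous_map_pairedI comp_def)

lemma flow_continuous_act: "g \<in> carrier G \<Longrightarrow> continuous_map X X (act g)"
  using flow_continuous_pair[of X "\<lambda>_. g" "\<lambda>x. x"] by (simp add: topspace_carrier)

lemma orbit_subset: "x \<in> topspace X \<Longrightarrow> orbit G act x \<subseteq> topspace X"
  using flow_closed by (auto simp: orbit_def)

lemma orbit_closure_invariant:
  assumes x: "x \<in> topspace X"
  shows "invariant act (X closure_of orbit G act x)"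
  unfolding invariant_def
proof (intro ballI)
  fix g y assume g: "g \<in> carrier G" and y: "y \<in> X closure_of orbit G act x"
  have "act g y \<in> X closure_of (act g ` orbit G act x)"
    using continuous_map_image_closure_subset[OF flow_continuous_act[OF g]] y by blast
  moreover have "act g ` orbit G act x \<subseteq> orbit G act x"
    using g x flow_mult by (auto simp: orbit_def simp flip: flow_mult)
  ultimately show "act g y \<in> X closure_of orbit G act x"
    using closure_of_mono by blast
qed

lemma subflow:
  assumes A: "closedin X A" "invariant act A"
  shows "flow G T (subtopology X A) (\<lambda>g. restrict (act g) A)"
proof -
  have AX: "A \<subseteq> topspace X" using A(1) by (rule closedin_subset)
  then have top: "topspace (subtopology X A) = A" by auto
  have "flow G T (subtopology X A) (\<lambda>g. restrict (act g) (topspace (subtopology X A)))"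
  proof (rule flowI)
    show "compact_space (subtopology X A)"
      using A(1) flow_compact by (simp add: closedin_compact_space compact_space_subtopology)
    show "Hausdorff_space (subtopology X A)"
      using flow_Hausdorff by (rule Hausdorff_space_subtopology)
    have "continuous_map (prod_topology T (subtopology X A)) X (\<lambda>z. act (fst z) (snd z))"
      using continuous_map_snd[of T "subtopology X A"]
      by (intro flow_continuous_pair continuous_map_fst) (simp add: continuous_map_in_subtopology)
    then show "continuous_map (prod_topology T (subtopology X A)) (subtopology X A) (\<lambda>(g, x). act g x)"
      using A(2) by (auto simp: continuous_map_in_subtopology invariant_def topspace_carrier case_prod_unfold)
  qed (use A AX flow_one flow_mult in \<open>auto simp: top invariant_def subset_iff\<close>)
  then show ?thesis by (simp only: top)
qed

end

text \<open>
  Orbit closures are the smallest closed invariant sets containing a given point.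
\<close>
lemma minimal_flow_iff:
  "minimal_flow G T X act \<longleftrightarrow> flow G T X act \<and> topspace X \<noteq> {} \<and>
    (\<forall>A. closedin X A \<and> invariant act A \<and> A \<noteq> {} \<longrightarrow> A = topspace X)"
proof (cases "flow G T X act")
  case flow: True
  show ?thesis
  proof
    assume min: "minimal_flow G T X act"
    have "A = topspace X" if A: "closedin X A" "invariant act A" "A \<noteq> {}" for A
    proof -
      obtain x where x: "x \<in> A" using A by blast
      have AX: "A \<subseteq> topspace X" using A(1) by (rule closedin_subset)
      have "orbit G act x \<subseteq> A" using A x by (auto simp: invariant_def orbit_def)
      then have "X closure_of orbit G act x \<subseteq> A" using A(1) by (rule closure_of_minimal)
      then show ?thesis using min x AX by (auto simp: minimal_flow_def)
    qed
    then show "flow G T X act \<and> topspace X \<noteq> {} \<and>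
        (\<forall>A. closedin X A \<and> invariant act A \<and> A \<noteq> {} \<longrightarrow> A = topspace X)"
      using min by (auto simp: minimal_flow_def)
  next
    assume min: "flow G T X act \<and> topspace X \<noteq> {} \<and>
      (\<forall>A. closedin X A \<and> invariant act A \<and> A \<noteq> {} \<longrightarrow> A = topspace X)"
    have "X closure_of orbit G act x = topspace X" if x: "x \<in> topspace X" for x
    proof -
      have "x \<in> orbit G act x" by (rule group_action.orbit_refl[OF flow_group_action[OF flow] x])
      then have "X closure_of orbit G act x \<noteq> {}"
        using closure_of_subset[OF orbit_subset[OF flow x]] by blast
      then show ?thesis using min orbit_closure_invariant[OF flow x] by simp
    qed
    with min show "minimal_flow G T X act" by (simp add: minimal_flow_def)
  qed
qed (simp add: minimal_flow_def)

lemma minimal_subflow: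
  assumes flow: "flow G T X act" and A0: "closedin X A0" "A0 \<noteq> {}" "invariant act A0"
  obtains A where "closedin X A" "invariant act A" "A \<noteq> {}" "A \<subseteq> A0"
    "minimal_flow G T (subtopology X A) (\<lambda>g. restrict (act g) A)"
proof -
  have "invariant act (\<Inter>\<C>)" if "\<forall>A\<in>\<C>. invariant act A" for \<C>
    using that by (simp add: invariant_def)
  then obtain A where A: "closedin X A" "A \<noteq> {}" "invariant act A" "A \<subseteq> A0"
    and min: "\<And>B. closedin X B \<Longrightarrow> B \<noteq> {} \<Longrightarrow> invariant act B \<Longrightarrow> B \<subseteq> A \<Longrightarrow> B = A"
    using minimal_closed_set[OF flow_compact[OF flow] A0(1,2), of "invariant act", OF A0(3)]
    by metis
  have AX: "A \<subseteq> topspace X" using A(1) by (rule closedin_subset)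
  then have top: "topspace (subtopology X A) = A" by auto
  have "B = A" if B: "closedin (subtopology X A) B" "invariant (\<lambda>g. restrict (act g) A) B" "B \<noteq> {}" for B
  proof (rule min)
    show "closedin X B" using B(1) A(1) closedin_trans_full by blast
    show BA: "B \<subseteq> A" using B(1) closedin_subset by fastforce
    show "invariant act B" using B(2) BA by (auto simp: invariant_def subset_iff)
  qed (fact B(3))
  then have "minimal_flow G T (subtopology X A) (\<lambda>g. restrict (act g) A)"
    using subflow[OF flow A(1,3)] A(2) unfolding minimal_flow_iff top by blast
  with that A show ?thesis by blast
qed

lemma flow_hom_image_closed_invariant:
  assumes "flow G T X actX" "flow G T Y actY" "flow_hom G X actX Y actY f"
    and "closedin X A" "invariant actX A"
  shows "closedin Y (f ` A)" "invariant actY (f ` A)"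
proof -
  show "closedin Y (f ` A)"
    using assms by (auto simp: flow_hom_def intro: compact_image_closedin flow_compact flow_Hausdorff)
  have "A \<subseteq> topspace X" using assms(4) by (rule closedin_subset)
  then have "actY g (f x) = f (actX g x)" if "g \<in> carrier G" "x \<in> A" for g x
    using that assms(3) by (auto simp: flow_hom_def)
  then show "invariant actY (f ` A)" using assms(5) by (auto simp: invariant_def)
qed

lemma flow_hom_onto_minimal:
  assumes "flow G T X actX" "topspace X \<noteq> {}" "minimal_flow G T Y actY"
    and "flow_hom G X actX Y actY f"
  shows "f ` topspace X = topspace Y"
  using flow_hom_image_closed_invariant[OF assms(1) _ assms(4) closedin_topspace]
    flow_closed[OF assms(1)] assms(2,3)
  by (auto simp: minimal_flow_iff invariant_def)

lemma minimal_flow_image: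
  assumes X: "minimal_flow G T X actX" and Y: "flow G T Y actY"
    and f: "flow_hom G X actX Y actY f" and onto: "f ` topspace X = topspace Y"
  shows "minimal_flow G T Y actY"
proof -
  have "A = topspace Y" if A: "closedin Y A" "invariant actY A" "A \<noteq> {}" for A
  proof -
    have AY: "A \<subseteq> topspace Y" using A(1) by (rule closedin_subset)
    let ?B = "{x \<in> topspace X. f x \<in> A}"
    have "closedin X ?B" using f A(1) by (auto simp: flow_hom_def closedin_continuous_map_preimage)
    moreover have "?B \<noteq> {}" using A(3) AY unfolding onto[symmetric] by auto
    moreover have "invariant actX ?B"
      using A(2) f flow_closed[of X actX] X by (simp add: invariant_def flow_hom_def minimal_flow_iff)
    ultimately have "?B = topspace X" using X by (auto simp: minimal_flow_iff)
    then have "f ` topspace X \<subseteq> A" by blast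
    then show ?thesis using onto AY by simp
  qed
  moreover have "topspace Y \<noteq> {}" using X onto unfolding minimal_flow_def by blast
  ultimately show ?thesis using Y unfolding minimal_flow_iff by blast
qed

lemma flow_hom_compose:
  assumes "flow_hom G X actX Y actY f" "flow_hom G Y actY Z actZ h"
  shows "flow_hom G X actX Z actZ (h \<circ> f)"
  using assms continuous_map_compose[of X Y f Z h] continuous_map_image_subset_topspace[of X Y f]
  by (auto simp: flow_hom_def image_subset_iff)

lemma flow_transport:
  assumes X: "flow G T X act" and f: "homeomorphic_maps X Y f f'"
  shows "flow G T Y (\<lambda>g. restrict (\<lambda>y. f (act g (f' y))) (topspace Y))"
    and "flow_hom G X act Y (\<lambda>g. restrict (\<lambda>y. f (act g (f' y))) (topspace Y)) f"
    and "flow_hom G Y (\<lambda>g. restrict (\<lambda>y. f (act g (f' y))) (topspace Y)) X act f'"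
proof -
  have cont: "continuous_map X Y f" "continuous_map Y X f'"
    and inv: "\<And>x. x \<in> topspace X \<Longrightarrow> f' (f x) = x" "\<And>y. y \<in> topspace Y \<Longrightarrow> f (f' y) = y"
    using f by (auto simp: homeomorphic_maps_def)
  have in_Y: "\<And>x. x \<in> topspace X \<Longrightarrow> f x \<in> topspace Y"
    and in_X: "\<And>y. y \<in> topspace Y \<Longrightarrow> f' y \<in> topspace X"
    using cont continuous_map_image_subset_topspace by blast+
  have "X homeomorphic_space Y" using f by (auto simp: homeomorphic_space_def)
  then have "compact_space Y" "Hausdorff_space Y"
    using flow_compact[OF X] flow_Hausdorff[OF X]
    by (simp_all add: homeomorphic_compact_space homeomorphic_Hausdorff_space)
  moreover have "continuous_map (prod_topology T Y) Y (\<lambda>(g, y). f (act g (f' y)))"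
    unfolding case_prod_unfold
    by (intro continuous_map_compose[OF flow_continuous_pair[OF X] cont(1), unfolded comp_def]
        continuous_map_compose[OF continuous_map_snd cont(2), unfolded comp_def] continuous_map_fst)
  ultimately show "flow G T Y (\<lambda>g. restrict (\<lambda>y. f (act g (f' y))) (topspace Y))"
    using in_X in_Y inv flow_closed[OF X] flow_one[OF X] flow_mult[OF X] by (intro flowI) auto
  show "flow_hom G X act Y (\<lambda>g. restrict (\<lambda>y. f (act g (f' y))) (topspace Y)) f"
    using cont in_Y inv by (auto simp: flow_hom_def)
  show "flow_hom G Y (\<lambda>g. restrict (\<lambda>y. f (act g (f' y))) (topspace Y)) X act f'"
    using cont in_X inv flow_closed[OF X] by (auto simp: flow_hom_def)
qed

text \<open>
  Universality is defined through flows whose points are sets of sets of group elements. A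
  minimal flow \<open>Y\<close> of any type has a copy of this kind: a point \<open>y\<close> is determined by the sets of
  group elements that move a base point \<open>y0\<close> into the various neighbourhoods of \<open>y\<close>, because
  the orbit of \<open>y0\<close> is dense and \<open>Y\<close> is Hausdorff.
\<close>
lemma universal_minimal_flow_hom:
  fixes M :: "'m topology" and Y :: "'y topology"
  assumes M: "universal_minimal_flow G T M actM" and Y: "minimal_flow G T Y actY"
  shows "\<exists>f. flow_hom G M actM Y actY f"
proof -
  have flowY: "flow G T Y actY" using Y by (simp add: minimal_flow_def)
  obtain y0 where y0: "y0 \<in> topspace Y" using Y unfolding minimal_flow_def by blast
  define times where "times U = {g \<in> carrier G. actY g y0 \<in> U}" for U
  define e where "e y = times ` {U. openin Y U \<and> y \<in> U}" for y
  have inj: "inj_on e (topspace Y)"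
  proof (rule inj_onI, rule ccontr)
    fix y z assume yz: "y \<in> topspace Y" "z \<in> topspace Y" "e y = e z" "y \<noteq> z"
    then obtain U V where UV: "openin Y U" "openin Y V" "y \<in> U" "z \<in> V" "disjnt U V"
      using flow_Hausdorff[OF flowY] unfolding Hausdorff_space_def by meson
    then have "times U \<in> e z" using yz(3) by (auto simp: e_def)
    then obtain W where W: "openin Y W" "z \<in> W" "times U = times W" by (auto simp: e_def)
    have "z \<in> Y closure_of orbit G actY y0" using Y y0 yz(2) by (simp add: minimal_flow_def)
    moreover have "openin Y (W \<inter> V)" "z \<in> W \<inter> V" using W UV by auto
    ultimately obtain x where "x \<in> orbit G actY y0" "x \<in> W \<inter> V" unfolding in_closure_of by blast
    then obtain g where "g \<in> carrier G" "actY g y0 \<in> W \<inter> V" by (auto simp: orbit_def)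
    then show False using W(3) UV(5) by (auto simp: times_def disjnt_iff)
  qed
  define e' where "e' = inv_into (topspace Y) e"
  define Y' where "Y' = pullback_topology (e ` topspace Y) e' Y"
  have e'e: "e' (e y) = y" if "y \<in> topspace Y" for y
    using that inj by (simp add: e'_def)
  have top: "topspace Y' = e ` topspace Y"
    using e'e by (auto simp: Y'_def topspace_pullback_topology)
  have "homeomorphic_maps Y Y' e e'"
    unfolding homeomorphic_maps_def
  proof (intro conjI)
    have "continuous_map Y Y (e' \<circ> e)"
      using continuous_map_id by (rule continuous_map_eq) (simp add: e'e)
    then show "continuous_map Y Y' e"
      unfolding Y'_def by (rule continuous_map_pullback') auto
    show "continuous_map Y' Y e'"
      using continuous_map_pullback[OF continuous_map_id, of "e ` topspace Y" e' Y] by (simp add: Y'_def)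
  qed (use e'e top in auto)
  note transport = flow_transport[OF flowY this]
  have "minimal_flow G T Y' (\<lambda>g. restrict (\<lambda>y. e (actY g (e' y))) (topspace Y'))"
    using minimal_flow_image[OF Y transport(1,2)] top by simp
  then obtain f where f: "flow_hom G M actM Y' (\<lambda>g. restrict (\<lambda>y. e (actY g (e' y))) (topspace Y')) f"
    using M unfolding universal_minimal_flow_def by blast
  from flow_hom_compose[OF f transport(3)] show ?thesis by blast
qed

end

section \<open>Endomorphisms of universal minimal flows\<close>

context topologized_group
begin

definition power_action :: "('g \<Rightarrow> 'x \<Rightarrow> 'x) \<Rightarrow> 'x topology \<Rightarrow> 'g \<Rightarrow> ('x \<Rightarrow> 'x) \<Rightarrow> 'x \<Rightarrow> 'x" where
  "power_action act X g =
     restrict (\<lambda>p. \<lambda>x\<in>topspace X. act g (p x)) (topspace X \<rightarrow>\<^sub>E topspace X)"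

lemma power_flow:
  assumes X: "flow G T X act"
  shows "flow G T (product_topology (\<lambda>_. X) (topspace X)) (power_action act X)"
proof -
  let ?P = "product_topology (\<lambda>_. X) (topspace X)"
  have "flow G T ?P (\<lambda>g. restrict (\<lambda>p. \<lambda>x\<in>topspace X. act g (p x)) (topspace ?P))"
  proof (rule flowI)
    show "compact_space ?P" "Hausdorff_space ?P"
      using flow_compact[OF X] flow_Hausdorff[OF X]
      by (simp_all add: compact_space_product_topology Hausdorff_space_product_topology)
    have "continuous_map (prod_topology T ?P) X (\<lambda>z. act (fst z) (snd z x))" if "x \<in> topspace X" for x
      using that
      by (intro flow_continuous_pair[OF X] continuous_map_fst
          continuous_map_compose[OF continuous_map_snd continuous_map_product_projection, unfolded comp_def])
    then show "continuous_map (prod_topology T ?P) ?P (\<lambda>(g, p). \<lambda>x\<in>topspace X. act g (p x))"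
      by (auto simp: continuous_map_componentwise case_prod_unfold)
    show "(\<lambda>x\<in>topspace X. act \<one> (p x)) = p" if "p \<in> topspace ?P" for p
      using that flow_one[OF X] by (intro extensionalityI[of _ "topspace X"]) (auto simp: PiE_iff)
  qed (use flow_closed[OF X] flow_mult[OF X] in \<open>auto simp: PiE_iff\<close>)
  then show ?thesis by (simp add: power_action_def[abs_def])
qed

text \<open>
  The closure \<open>E\<close> of the translations in \<open>X\<^sup>X\<close> is the enveloping semigroup under composition.
  For fixed \<open>q \<in> L\<close>, the conditions \<open>pq \<in> L\<close> and \<open>\<psi>(pq) = p\<psi>(q)\<close> are closed in \<open>p\<close> and hold
  for translations, hence for all \<open>p \<in> E\<close>. So \<open>L\<close> is a left ideal and \<open>\<psi>\<close> is
  equivariant under left multiplication. Right multiplication by an element of \<open>L\<close>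
  is itself a flow endomorphism, so minimality of \<open>L\<close> as a flow yields left simplicity.
\<close>
lemma minimal_ideal_endomorphism_inj:
  fixes act :: "'g \<Rightarrow> 'x \<Rightarrow> 'x"
  defines "P \<equiv> \<lambda>X. product_topology (\<lambda>_. X) (topspace X)"
  assumes X: "flow G T X act"
    and LE: "L \<subseteq> P X closure_of orbit G (power_action act X) (\<lambda>x\<in>topspace X. x)"
    and L: "minimal_flow G T (subtopology (P X) L) (\<lambda>g. restrict (power_action act X g) L)"
    and closed: "closedin (P X) L" and inv: "invariant (power_action act X) L"
    and \<psi>: "flow_hom G (subtopology (P X) L) (\<lambda>g. restrict (power_action act X g) L)
      (subtopology (P X) L) (\<lambda>g. restrict (power_action act X g) L) \<psi>"
  shows "inj_on \<psi> L"
proof -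
  define S where "S = topspace X"
  define Orb where "Orb = orbit G (power_action act X) (\<lambda>x\<in>S. x)"
  define E where "E = P X closure_of Orb"
  let ?A = "power_action act X"
  let ?Y = "subtopology (P X) L"
  have topP: "topspace (P X) = S \<rightarrow>\<^sub>E S" by (simp add: P_def S_def)
  have flowP: "flow G T (P X) ?A" unfolding P_def by (rule power_flow[OF X])
  have LP: "L \<subseteq> topspace (P X)" using closed by (rule closedin_subset)
  have top: "topspace ?Y = L" using LP by auto
  have Haus: "Hausdorff_space (P X)" by (rule flow_Hausdorff[OF flowP])
  have flowL: "flow G T ?Y (\<lambda>g. restrict (?A g) L)" and ne: "L \<noteq> {}"
    using L top unfolding minimal_flow_def by auto
  have L_E: "L \<subseteq> E" using LE by (simp add: E_def Orb_def S_def)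
  have comp: "compose S p q \<in> topspace (P X)" if "p \<in> topspace (P X)" "q \<in> topspace (P X)" for p q
    using that by (auto simp: topP compose_def PiE_iff)
  have right_mult: "continuous_map (P X) (P X) (\<lambda>p. compose S p q)" if q: "q \<in> topspace (P X)" for q
  proof -
    have "continuous_map (P X) X (\<lambda>p. p (q x))" if "x \<in> S" for x
      using that q unfolding P_def S_def
      by (intro continuous_map_product_projection) (auto simp: PiE_iff)
    then show ?thesis
      by (auto simp: P_def continuous_map_componentwise S_def compose_def)
  qed
  have Orb: "\<exists>g\<in>carrier G. \<forall>q\<in>topspace (P X). compose S p q = ?A g q" if p: "p \<in> Orb" for p
  proof -
    have id: "(\<lambda>x\<in>S. x) \<in> S \<rightarrow>\<^sub>E S" by auto
    then obtain g where g: "g \<in> carrier G" "p = (\<lambda>x\<in>S. act g x)"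
      using p by (auto simp: Orb_def orbit_def power_action_def S_def cong: restrict_cong)
    then have "compose S p q = ?A g q" if "q \<in> topspace (P X)" for q
      using that by (auto simp: compose_def power_action_def topP PiE_iff S_def)
    then show ?thesis using g by blast
  qed
  have id: "(\<lambda>x\<in>S. x) \<in> topspace (P X)" by (simp add: topP)
  have OrbP: "Orb \<subseteq> topspace (P X)"
    unfolding Orb_def using id by (rule orbit_subset[OF flowP])
  have EP: "E \<subseteq> topspace (P X)" by (simp add: E_def closure_of_subset_topspace)
  have ideal: "compose S p q \<in> L" if p: "p \<in> E" and q: "q \<in> L" for p q
    using p unfolding E_def
  proof (rule forall_in_closure_of)
    fix p assume "p \<in> Orb"
    then show "compose S p q \<in> L"
      using Orb[of p] inv q LP by (force simp: invariant_def)
  next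
    show "closedin (P X) {p \<in> topspace (P X). compose S p q \<in> L}"
      using right_mult closed q LP by (intro closedin_continuous_map_preimage) auto
  qed
  have right_mult_L: "continuous_map ?Y ?Y (\<lambda>p. compose S p q)" if "q \<in> L" for q
    using that right_mult[of q] LP L_E ideal
    by (auto simp: continuous_map_in_subtopology intro: continuous_map_from_subtopology)
  have \<psi>_cont: "continuous_map ?Y ?Y \<psi>" using \<psi> by (simp add: flow_hom_def)
  have \<psi>_L: "\<psi> a \<in> L" if "a \<in> L" for a
    using continuous_map_image_subset_topspace[OF \<psi>_cont] that top by auto
  have \<psi>_act: "\<psi> (?A g a) = ?A g (\<psi> a)" if "g \<in> carrier G" "a \<in> L" for g a
    using \<psi> that top \<psi>_L[OF that(2)] unfolding flow_hom_def by auto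
  have \<psi>_mult: "\<psi> (compose S p b) = compose S p (\<psi> b)" if p: "p \<in> E" and b: "b \<in> L" for p b
  proof (rule forall_in_closure_of_eq[where f = "\<lambda>p. \<psi> (compose S p b)"
        and g = "\<lambda>p. compose S p (\<psi> b)" and S = Orb and Y = "P X"])
    let ?E = "subtopology (P X) E"
    show "Hausdorff_space (P X)" by (rule Haus)
    have "Orb \<subseteq> E" using OrbP by (simp add: E_def closure_of_subset)
    then show "p \<in> ?E closure_of Orb"
      using p by (simp add: closure_of_subtopology Int_absorb1 E_def)
    have "continuous_map ?E ?Y (\<lambda>p. compose S p b)"
      using right_mult[of b] b LP ideal
      by (auto simp: continuous_map_in_subtopology intro: continuous_map_from_subtopology)
    then have "continuous_map ?E ?Y (\<psi> \<circ> (\<lambda>p. compose S p b))"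
      using \<psi>_cont by (rule continuous_map_compose)
    then show "continuous_map ?E (P X) (\<lambda>p. \<psi> (compose S p b))"
      by (simp add: continuous_map_in_subtopology comp_def)
    show "continuous_map ?E (P X) (\<lambda>p. compose S p (\<psi> b))"
      using \<psi>_L[OF b] LP by (intro continuous_map_from_subtopology right_mult) auto
    fix p assume "p \<in> Orb"
    then obtain g where g: "g \<in> carrier G" "\<forall>q\<in>topspace (P X). compose S p q = ?A g q"
      using Orb by blast
    moreover have "b \<in> topspace (P X)" "\<psi> b \<in> topspace (P X)" using b \<psi>_L[OF b] LP by auto
    ultimately show "\<psi> (compose S p b) = compose S p (\<psi> b)"
      using \<psi>_act[OF g(1) b] by simp
  qed
  have "inj_on \<psi> (topspace ?Y)"
  proof (rule left_simple_equivariant_inj[where mul = "compose S"])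
    show "compact_space ?Y" "Hausdorff_space ?Y"
      by (rule flow_compact[OF flowL] flow_Hausdorff[OF flowL])+
    show "topspace ?Y \<noteq> {}" using ne top by simp
    fix a b c assume a: "a \<in> topspace ?Y" and b: "b \<in> topspace ?Y" and c: "c \<in> topspace ?Y"
    have "c \<in> S \<rightarrow> S" using c top LP topP by (auto simp: PiE_iff)
    then show "compose S (compose S a b) c = compose S a (compose S b c)"
      by (rule compose_assoc[symmetric])
  next
    fix b assume "b \<in> topspace ?Y"
    then have b: "b \<in> L" using top by simp
    show "(\<lambda>a. compose S a b) ` topspace ?Y = topspace ?Y"
    proof -
      let ?B = "(\<lambda>a. compose S a b) ` L"
      have hom: "flow_hom G ?Y (\<lambda>g. restrict (?A g) L) ?Y (\<lambda>g. restrict (?A g) L) (\<lambda>a. compose S a b)"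
        unfolding flow_hom_def
      proof (intro conjI ballI)
        fix g a assume g: "g \<in> carrier G" and "a \<in> topspace ?Y"
        then have a: "a \<in> L" using top by simp
        have "b x \<in> S" if "x \<in> S" for x using b LP topP that by (auto simp: PiE_iff)
        then have "compose S (?A g a) b = ?A g (compose S a b)"
          using a b LP topP comp[of a b]
          by (auto simp: compose_def power_action_def S_def subset_iff fun_eq_iff)
        then show "compose S (restrict (?A g) L a) b = restrict (?A g) L (compose S a b)"
          using a ideal[OF _ b] L_E by (auto simp: subset_iff)
      qed (rule right_mult_L[OF b])
      show ?thesis
        by (rule flow_hom_onto_minimal[OF flowL _ L hom]) (use ne top in simp)
    qed
  qed (use ideal L_E right_mult_L \<psi>_L \<psi>_mult top in auto)
  then show ?thesis by (simp only: top)
qed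

text \<open>
  Evaluation at a point \<open>m\<close> maps a minimal left ideal \<open>L\<close> onto \<open>M\<close>, and universality gives a
  map \<open>f\<close> back to \<open>L\<close>. The composite \<open>L \<rightarrow> M \<rightarrow> M \<rightarrow> L\<close> with \<open>\<phi>\<close> in the middle is injective, which
  forces \<open>\<phi>\<close> to be injective on the image of the evaluation.
\<close>
theorem universal_minimal_flow_endomorphism_inj:
  assumes M: "universal_minimal_flow G T M act" and \<phi>: "flow_hom G M act M act \<phi>"
  shows "inj_on \<phi> (topspace M)"
proof -
  let ?P = "product_topology (\<lambda>_. M) (topspace M)"
  let ?A = "power_action act M"
  have min: "minimal_flow G T M act" using M by (simp add: universal_minimal_flow_def)
  then have flow: "flow G T M act" by (simp add: minimal_flow_def)
  have flowP: "flow G T ?P ?A" by (rule power_flow[OF flow])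
  let ?id = "\<lambda>x\<in>topspace M. x"
  let ?E = "?P closure_of orbit G ?A ?id"
  have id: "?id \<in> topspace ?P" by simp
  have "?id \<in> orbit G ?A ?id"
    using group_action.orbit_refl[OF flow_group_action[OF flowP] id] .
  then have "?E \<noteq> {}" using closure_of_subset[OF orbit_subset[OF flowP id]] by blast
  then obtain L where L: "closedin ?P L" "invariant ?A L" "L \<noteq> {}" "L \<subseteq> ?E"
    "minimal_flow G T (subtopology ?P L) (\<lambda>g. restrict (?A g) L)"
    using minimal_subflow[OF flowP closedin_closure_of _ orbit_closure_invariant[OF flowP id]] by blast
  let ?Y = "subtopology ?P L" and ?B = "\<lambda>g. restrict (?A g) L"
  have LP: "L \<subseteq> topspace ?P" using L(1) by (rule closedin_subset)
  have top: "topspace ?Y = L" using LP by auto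
  obtain m where m: "m \<in> topspace M" using min unfolding minimal_flow_def by blast
  have ev: "flow_hom G ?Y ?B M act (\<lambda>p. p m)"
    unfolding flow_hom_def
  proof (intro conjI ballI)
    show "continuous_map ?Y M (\<lambda>p. p m)"
      using m by (intro continuous_map_from_subtopology continuous_map_product_projection)
    fix g p assume "g \<in> carrier G" "p \<in> topspace ?Y"
    then have "p \<in> L" "p \<in> topspace M \<rightarrow>\<^sub>E topspace M" using top LP by auto
    then show "?B g p m = act g (p m)" using m by (simp add: power_action_def)
  qed
  have onto: "(\<lambda>p. p m) ` L = topspace M"
    using flow_hom_onto_minimal[OF _ _ min ev] L(3,5) top unfolding minimal_flow_def by simp
  obtain f where f: "flow_hom G M act ?Y ?B f"
    using universal_minimal_flow_hom[OF M L(5)] by blast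
  have "inj_on (f \<circ> (\<phi> \<circ> (\<lambda>p. p m))) L"
    using minimal_ideal_endomorphism_inj[OF flow L(4,5,1,2)]
      flow_hom_compose[OF flow_hom_compose[OF ev \<phi>] f] by blast
  then have "inj_on (\<phi> \<circ> (\<lambda>p. p m)) L" by (rule inj_on_imageI2)
  then have "inj_on \<phi> ((\<lambda>p. p m) ` L)" by (auto simp: inj_on_def)
  then show ?thesis by (simp only: onto)
qed

text \<open>
  The composite \<open>M \<rightarrow> C \<rightarrow> M\<close> is injective, hence so is its first map. This includes the
  uniqueness of the universal minimal flow.
\<close>
corollary minimal_flow_over_universal_iso:
  assumes M: "universal_minimal_flow G T M actM" and C: "minimal_flow G T C actC"
    and h: "flow_hom G C actC M actM h"
  obtains f where "flow_iso G M actM C actC f"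
proof -
  obtain f where f: "flow_hom G M actM C actC f"
    using universal_minimal_flow_hom[OF M C] by blast
  have "f ` topspace M = topspace C"
    using M by (intro flow_hom_onto_minimal[OF _ _ C f])
      (auto simp: universal_minimal_flow_def minimal_flow_def)
  have "inj_on (h \<circ> f) (topspace M)"
    using universal_minimal_flow_endomorphism_inj[OF M flow_hom_compose[OF f h]] .
  then have "inj_on f (topspace M)" by (rule inj_on_imageI2)
  with f \<open>f ` topspace M = topspace C\<close> that show ?thesis by (simp add: flow_iso_def bij_betw_def)
qed

end

section \<open>Compact open normal subgroups\<close>

sublocale topological_group \<subseteq> topologized_group
  by unfold_locales (rule topspace_eq)

lemma (in topological_group) continuous_map_mult:
  assumes "continuous_map X T f" "continuous_map X T g"
  shows "continuous_map X T (\<lambda>x. f x \<otimes> g x)"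
  using continuous_map_compose[OF continuous_map_pairedI[OF assms] continuous_mult]
  by (simp add: comp_def)

lemma (in topological_group) continuous_map_inverse:
  assumes "continuous_map X T f"
  shows "continuous_map X T (\<lambda>x. inv (f x))"
  using continuous_map_compose[OF assms continuous_inv] by (simp add: comp_def)

text \<open>
  Components are closed, so the neutral element is a closed point, and the diagonal is its preimage
  under \<open>(x, y) \<mapsto> x\<inverse>y\<close>.
\<close>
lemma (in topological_group) totally_disconnected_imp_Hausdorff:
  assumes "totally_disconnected_space T"
  shows "Hausdorff_space T"
proof -
  have "connected_component_of_set T \<one> = {\<one>}"
    using assms by (simp add: totally_disconnected_space_def topspace_eq)
  then have "closedin T {\<one>}"
    by (metis closedin_connected_component_of)
  moreover have "continuous_map (prod_topology T T) T (\<lambda>z. inv (fst z) \<otimes> snd z)"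
    by (intro continuous_map_mult continuous_map_inverse continuous_map_fst continuous_map_snd)
  ultimately have "closedin (prod_topology T T)
      {z \<in> topspace (prod_topology T T). inv (fst z) \<otimes> snd z \<in> {\<one>}}"
    by (intro closedin_continuous_map_preimage)
  moreover have "inv x \<otimes> y = \<one> \<longleftrightarrow> x = y" if "x \<in> carrier G" "y \<in> carrier G" for x y
    using inv_solve_left[of \<one> x y] that by auto
  then have "{z \<in> topspace (prod_topology T T). inv (fst z) \<otimes> snd z \<in> {\<one>}} =
      (\<lambda>x. (x, x)) ` topspace T"
    by (auto simp: topspace_eq)
  ultimately show ?thesis by (simp add: Hausdorff_space_closedin_diagonal)
qed

locale compact_open_normal_subgroup = topological_group G T + normal K G
  for G (structure) and T and K +
  assumes Hausdorff: "Hausdorff_space T"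
    and compact: "compactin T K" and "open": "openin T K"
begin

lemma coset_open:
  assumes g: "g \<in> carrier G"
  shows "openin T (K #> g)"
proof -
  have "continuous_map T T (\<lambda>x. x \<otimes> inv g)"
    using g by (intro continuous_map_mult) (auto simp: topspace_eq)
  then have "openin T {x \<in> topspace T. x \<otimes> inv g \<in> K}"
    using "open" by (rule openin_continuous_map_preimage)
  moreover have "{x \<in> topspace T. x \<otimes> inv g \<in> K} = K #> g"
  proof (intro equalityI subsetI)
    fix x assume "x \<in> {x \<in> topspace T. x \<otimes> inv g \<in> K}"
    then have x: "x \<in> carrier G" "x \<otimes> inv g \<in> K" by (auto simp: topspace_eq)
    then have "x = (x \<otimes> inv g) \<otimes> g" using g by (simp add: m_assoc)
    then show "x \<in> K #> g" using x(2) by (auto simp: r_coset_def)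
  next
    fix x assume "x \<in> K #> g"
    then obtain k where "k \<in> K" "x = k \<otimes> g" by (auto simp: r_coset_def)
    then show "x \<in> {x \<in> topspace T. x \<otimes> inv g \<in> K}"
      using g by (simp add: topspace_eq m_assoc)
  qed
  ultimately show ?thesis by simp
qed

definition equivariant_maps :: "('a \<Rightarrow> 'a) set" where
  "equivariant_maps = {\<omega> \<in> carrier G \<rightarrow>\<^sub>E K. \<forall>h\<in>carrier G. \<forall>k\<in>K. \<omega> (k \<otimes> h) = k \<otimes> \<omega> h}"

lemma equivariant_mapsD:
  "\<omega> \<in> equivariant_maps \<Longrightarrow> h \<in> carrier G \<Longrightarrow> k \<in> K \<Longrightarrow> \<omega> (k \<otimes> h) = k \<otimes> \<omega> h"
  by (simp add: equivariant_maps_def)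

definition equivariant_topology :: "('a \<Rightarrow> 'a) topology" where
  "equivariant_topology = subtopology (product_topology (\<lambda>_. subtopology T K) (carrier G)) equivariant_maps"

definition translate :: "'a \<Rightarrow> ('a \<Rightarrow> 'a) \<Rightarrow> 'a \<Rightarrow> 'a" where
  "translate g \<omega> = (\<lambda>h\<in>carrier G. \<omega> (h \<otimes> g))"

lemma topspace_Int_K: "topspace T \<inter> K = K"
  using subset by (auto simp: topspace_eq)

lemma topspace_equivariant: "topspace equivariant_topology = equivariant_maps"
  by (auto simp: equivariant_topology_def equivariant_maps_def topspace_Int_K)

text \<open>
  Dividing every \<open>g\<close> by a chosen representative of its coset \<open>Kg\<close> is equivariant.
\<close>
lemma equivariant_maps_nonempty: "equivariant_maps \<noteq> {}"
proof -
  define s where "s A = (SOME x. x \<in> A)" for A :: "'a set"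
  have s: "s (K #> g) \<in> K #> g" if "g \<in> carrier G" for g
    unfolding s_def using rcos_self[OF that is_subgroup] by (rule someI)
  have sG: "s (K #> g) \<in> carrier G" if "g \<in> carrier G" for g
    using s[OF that] that r_coset_subset_G[OF subset] by blast
  have K: "g \<otimes> inv (s (K #> g)) \<in> K" if g: "g \<in> carrier G" for g
  proof -
    obtain k where k: "k \<in> K" "s (K #> g) = k \<otimes> g"
      using s[OF g] by (auto simp: r_coset_def)
    then have "g \<otimes> inv (s (K #> g)) = inv k"
      using g by (simp add: inv_mult_group flip: m_assoc)
    then show ?thesis using k by simp
  qed
  have "(\<lambda>g\<in>carrier G. g \<otimes> inv (s (K #> g))) \<in> equivariant_maps"
    unfolding equivariant_maps_def
  proof (intro CollectI conjI ballI)
    fix h k assume h: "h \<in> carrier G" and k: "k \<in> K"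
    have "K #> (k \<otimes> h) = K #> h"
      using h k is_subgroup by (intro repr_independence[symmetric]) (auto simp: r_coset_def)
    then show "(\<lambda>g\<in>carrier G. g \<otimes> inv (s (K #> g))) (k \<otimes> h) =
        k \<otimes> (\<lambda>g\<in>carrier G. g \<otimes> inv (s (K #> g))) h"
      using h k sG by (simp add: m_assoc)
  qed (use K in auto)
  then show ?thesis by blast
qed

lemma equivariant_maps_translate:
  assumes \<omega>: "\<omega> \<in> equivariant_maps" and g: "g \<in> carrier G"
  shows "translate g \<omega> \<in> equivariant_maps"
  using assms by (auto simp: equivariant_maps_def translate_def PiE_iff m_assoc)

lemma equivariant_maps_closed:
  "closedin (product_topology (\<lambda>_. subtopology T K) (carrier G)) equivariant_maps"
proof -
  let ?P = "product_topology (\<lambda>_. subtopology T K) (carrier G)"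
  have "closedin ?P {\<omega> \<in> topspace ?P. \<omega> (k \<otimes> h) = k \<otimes> \<omega> h}" if "h \<in> carrier G" "k \<in> K" for h k
  proof (rule closedin_continuous_maps_eq[OF Hausdorff])
    have proj: "continuous_map ?P T (\<lambda>\<omega>. \<omega> x)" if "x \<in> carrier G" for x
      using continuous_map_product_projection[OF that, of "\<lambda>_. subtopology T K"]
      by (simp add: continuous_map_in_subtopology)
    show "continuous_map ?P T (\<lambda>\<omega>. \<omega> (k \<otimes> h))" using that by (intro proj) simp
    show "continuous_map ?P T (\<lambda>\<omega>. k \<otimes> \<omega> h)"
      using that by (intro continuous_map_mult proj) (simp_all add: topspace_eq)
  qed
  moreover have "K \<noteq> {}" using subgroup.one_closed[OF is_subgroup] by (metis empty_iff)
  ultimately have "closedin ?P (topspace ?P \<inter>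
      (\<Inter>z\<in>carrier G \<times> K. {\<omega> \<in> topspace ?P. \<omega> (snd z \<otimes> fst z) = snd z \<otimes> \<omega> (fst z)}))"
    by (intro closedin_Int closedin_topspace closedin_Inter) auto
  moreover have "topspace ?P \<inter>
      (\<Inter>z\<in>carrier G \<times> K. {\<omega> \<in> topspace ?P. \<omega> (snd z \<otimes> fst z) = snd z \<otimes> \<omega> (fst z)}) =
      equivariant_maps"
    by (auto simp: equivariant_maps_def topspace_Int_K)
  ultimately show ?thesis by simp
qed

text \<open>
  The coordinate at \<open>h\<close> is the map \<open>(g, \<omega>) \<mapsto> \<omega>(hg)\<close>. On the open set where \<open>g \<in> Ka\<close>,
  equivariance rewrites it as \<open>(hg(ha)\<inverse>) \<omega>(ha)\<close>, because \<open>hg(ha)\<inverse> = h(ga\<inverse>)h\<inverse>\<close> lies in the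
  normal subgroup \<open>K\<close>; there \<open>\<omega>\<close> is evaluated at a fixed point and the formula is visibly
  continuous.
\<close>
lemma translate_continuous:
  "continuous_map (prod_topology T equivariant_topology) equivariant_topology (\<lambda>(g, \<omega>). translate g \<omega>)"
proof -
  let ?Z = "prod_topology T equivariant_topology"
  have proj: "continuous_map equivariant_topology T (\<lambda>\<omega>. \<omega> x)" if "x \<in> carrier G" for x
    using continuous_map_product_projection[OF that, of "\<lambda>_. subtopology T K"]
    by (auto simp: continuous_map_in_subtopology equivariant_topology_def intro: continuous_map_from_subtopology)
  have coord: "continuous_map ?Z T (\<lambda>z. (snd z) (h \<otimes> fst z))" if h: "h \<in> carrier G" for h
  proof (rule pasting_lemma[where I = "carrier G" and T = "\<lambda>a. (K #> a) \<times> equivariant_maps"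
        and f = "\<lambda>a z. (h \<otimes> fst z \<otimes> inv (h \<otimes> a)) \<otimes> (snd z) (h \<otimes> a)"])
    have coset_value: "(h \<otimes> fst z \<otimes> inv (h \<otimes> a)) \<otimes> (snd z) (h \<otimes> a) = (snd z) (h \<otimes> fst z)"
      if a: "a \<in> carrier G" and z: "z \<in> (K #> a) \<times> equivariant_maps" for a z
    proof -
      obtain k \<omega> where z: "z = (k \<otimes> a, \<omega>)" "k \<in> K" "\<omega> \<in> equivariant_maps"
        using z by (auto simp: r_coset_def)
      have k: "k \<in> carrier G" using z by simp
      have "h \<otimes> k \<otimes> inv h \<in> K" using z h by (simp add: inv_op_closed2)
      moreover have "h \<otimes> (k \<otimes> a) \<otimes> inv (h \<otimes> a) = h \<otimes> k \<otimes> inv h"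
        using h a k by (simp add: m_assoc inv_mult_group) (simp flip: m_assoc)
      moreover have "h \<otimes> (k \<otimes> a) = (h \<otimes> k \<otimes> inv h) \<otimes> (h \<otimes> a)"
        using h a k by (simp add: m_assoc) (simp flip: m_assoc)
      ultimately show ?thesis using z a h by (simp add: equivariant_maps_def)
    qed
    show "openin ?Z ((K #> a) \<times> equivariant_maps)" if "a \<in> carrier G" for a
      using coset_open[OF that] topspace_equivariant by (metis openin_prod_Times_iff openin_topspace)
    show "continuous_map (subtopology ?Z ((K #> a) \<times> equivariant_maps)) T
        (\<lambda>z. (h \<otimes> fst z \<otimes> inv (h \<otimes> a)) \<otimes> (snd z) (h \<otimes> a))" if a: "a \<in> carrier G" for a
      using h a
      by (intro continuous_map_from_subtopology continuous_map_mult continuous_map_fst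
          continuous_map_compose[OF continuous_map_snd proj, unfolded comp_def])
        (auto simp: topspace_eq)
    show "h \<otimes> fst z \<otimes> inv (h \<otimes> a) \<otimes> snd z (h \<otimes> a) = h \<otimes> fst z \<otimes> inv (h \<otimes> b) \<otimes> snd z (h \<otimes> b)"
      if "a \<in> carrier G" "b \<in> carrier G"
        "z \<in> topspace ?Z \<inter> (K #> a) \<times> equivariant_maps \<inter> (K #> b) \<times> equivariant_maps" for a b z
      using coset_value[of a z] coset_value[of b z] that by auto
    show "\<exists>a. a \<in> carrier G \<and> z \<in> (K #> a) \<times> equivariant_maps \<and>
        snd z (h \<otimes> fst z) = h \<otimes> fst z \<otimes> inv (h \<otimes> a) \<otimes> snd z (h \<otimes> a)"
      if z: "z \<in> topspace ?Z" for z
    proof (intro exI conjI)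
      show a: "fst z \<in> carrier G" using z by (auto simp: topspace_eq)
      show "z \<in> (K #> fst z) \<times> equivariant_maps"
        using z rcos_self[OF a is_subgroup] by (auto simp: topspace_equivariant)
      then show "snd z (h \<otimes> fst z) = h \<otimes> fst z \<otimes> inv (h \<otimes> fst z) \<otimes> snd z (h \<otimes> fst z)"
        using coset_value[OF a] by simp
    qed
  qed
  have coord': "continuous_map ?Z (subtopology T K) (\<lambda>z. (snd z) (h \<otimes> fst z))"
    if h: "h \<in> carrier G" for h
    using coord[OF h] h
    by (auto simp: continuous_map_in_subtopology topspace_equivariant topspace_eq equivariant_maps_def PiE_iff)
  show ?thesis
    unfolding case_prod_unfold
    by (subst (2) equivariant_topology_def)
      (use coord' equivariant_maps_translate in
        \<open>auto simp: continuous_map_in_subtopology continuous_map_componentwise translate_def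
          topspace_equivariant topspace_eq\<close>)
qed

lemma translation_flow: "flow G T equivariant_topology (\<lambda>g. restrict (translate g) equivariant_maps)"
proof -
  let ?P = "product_topology (\<lambda>_. subtopology T K) (carrier G)"
  have "flow G T equivariant_topology (\<lambda>g. restrict (translate g) (topspace equivariant_topology))"
  proof (rule flowI)
    have "compact_space ?P"
      using compact by (simp add: compact_space_product_topology compact_space_subtopology)
    then show "compact_space equivariant_topology"
      unfolding equivariant_topology_def
      by (intro compact_space_subtopology closedin_compact_space equivariant_maps_closed)
    show "Hausdorff_space equivariant_topology"
      unfolding equivariant_topology_def
      by (simp add: Hausdorff Hausdorff_space_product_topology Hausdorff_space_subtopology)
  next
    fix \<omega> assume "\<omega> \<in> topspace equivariant_topology"
    then have \<omega>: "\<omega> \<in> carrier G \<rightarrow>\<^sub>E K" by (simp add: topspace_equivariant equivariant_maps_def)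
    show "translate \<one> \<omega> = \<omega>"
      using \<omega> by (intro extensionalityI[of _ "carrier G"]) (auto simp: translate_def PiE_iff)
    show "translate (g \<otimes> h) \<omega> = translate g (translate h \<omega>)"
      if "g \<in> carrier G" "h \<in> carrier G" for g h
      using that by (auto simp: translate_def m_assoc)
  qed (simp_all add: equivariant_maps_translate topspace_equivariant translate_continuous)
  then show ?thesis by (simp only: topspace_equivariant)
qed

text \<open>
  Evaluating at the neutral element turns translation by \<open>k\<close> into \<open>\<omega>(k) = k\<omega>(1)\<close>.
\<close>
lemma equivariant_map_to_K:
  assumes M: "universal_minimal_flow G T M actM"
  obtains F where "continuous_map M (subtopology T K) F"
    "\<And>k x. k \<in> K \<Longrightarrow> x \<in> topspace M \<Longrightarrow> F (actM k x) = k \<otimes> F x"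
proof -
  let ?A = "\<lambda>g. restrict (translate g) equivariant_maps"
  have "invariant ?A (topspace equivariant_topology)"
    using equivariant_maps_translate by (simp add: invariant_def topspace_equivariant)
  then obtain L where L: "closedin equivariant_topology L"
      "minimal_flow G T (subtopology equivariant_topology L) (\<lambda>g. restrict (?A g) L)"
    using minimal_subflow[OF translation_flow closedin_topspace] equivariant_maps_nonempty topspace_equivariant
    by metis
  have L_sub: "L \<subseteq> equivariant_maps" using closedin_subset[OF L(1)] by (simp only: topspace_equivariant)
  obtain f where f: "flow_hom G M actM (subtopology equivariant_topology L) (\<lambda>g. restrict (?A g) L) f"
    using universal_minimal_flow_hom[OF M L(2)] by blast
  have fL: "f x \<in> L" if "x \<in> topspace M" for x
    using f that by (auto simp: flow_hom_def continuous_map_in_subtopology)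
  show ?thesis
  proof
    have "continuous_map M (product_topology (\<lambda>_. subtopology T K) (carrier G)) f"
      using f by (simp add: flow_hom_def continuous_map_in_subtopology equivariant_topology_def)
    then show "continuous_map M (subtopology T K) (\<lambda>x. f x \<one>)"
      by (simp add: continuous_map_componentwise)
    fix k x assume k: "k \<in> K" and x: "x \<in> topspace M"
    have "f (actM k x) = translate k (f x)"
      using f k x fL[OF x] L_sub by (auto simp: flow_hom_def subset_iff)
    then have "f (actM k x) \<one> = f x (k \<otimes> \<one>)"
      using k by (simp add: translate_def)
    also have "\<dots> = k \<otimes> f x \<one>"
      using equivariant_mapsD[of "f x" \<one> k] k fL[OF x] L_sub by auto
    finally show "f (actM k x) \<one> = k \<otimes> f x \<one>" .
  qed
qed

section \<open>The slice and the quotient group\<close>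

abbreviation quotient_topology :: "'a set topology" where
  "quotient_topology \<equiv> discrete_topology (carrier (G Mod K))"

lemma quotient_topologized_group: "topologized_group (G Mod K) quotient_topology"
  by (intro topologized_group.intro topologized_group_axioms.intro factorgroup_is_group) simp

lemma coset_map_continuous: "continuous_map T quotient_topology (\<lambda>g. K #> g)"
proof -
  have "openin T {g \<in> topspace T. K #> g \<in> U}" for U
  proof (subst openin_subopen, intro ballI exI conjI)
    fix g assume "g \<in> {g \<in> topspace T. K #> g \<in> U}"
    then have g: "g \<in> carrier G" "K #> g \<in> U" by (auto simp: topspace_eq)
    show "openin T (K #> g)" by (rule coset_open[OF g(1)])
    show "g \<in> K #> g" by (rule rcos_self[OF g(1) is_subgroup])
    show "K #> g \<subseteq> {g \<in> topspace T. K #> g \<in> U}"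
      using g repr_independence[OF _ g(1) is_subgroup] r_coset_subset_G[OF subset g(1)]
      by (auto simp: topspace_eq)
  qed
  then show ?thesis
    by (auto simp: continuous_map_def topspace_eq carrier_FactGroup)
qed

lemma inflated_flow:
  assumes N: "flow (G Mod K) quotient_topology N actN"
  shows "flow G T N (\<lambda>g. restrict (actN (K #> g)) (topspace N))"
proof -
  interpret Q: topologized_group "G Mod K" quotient_topology by (rule quotient_topologized_group)
  have Q: "K #> g \<in> carrier (G Mod K)" if "g \<in> carrier G" for g
    using that by (auto simp: carrier_FactGroup)
  show ?thesis
  proof (rule flowI)
    show "compact_space N" "Hausdorff_space N"
      by (rule Q.flow_compact[OF N] Q.flow_Hausdorff[OF N])+
    have "continuous_map (prod_topology T N) N (\<lambda>z. actN (K #> fst z) (snd z))"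
      by (intro Q.flow_continuous_pair[OF N] continuous_map_snd
          continuous_map_compose[OF continuous_map_fst coset_map_continuous, unfolded comp_def])
    then show "continuous_map (prod_topology T N) N (\<lambda>(g, x). actN (K #> g) x)"
      by (simp add: case_prod_unfold)
    show "actN (K #> \<one>) x = x" if "x \<in> topspace N" for x
      using Q.flow_one[OF N that] coset_mult_one[OF subset] by simp
    show "actN (K #> (g \<otimes> h)) x = actN (K #> g) (actN (K #> h) x)"
      if "g \<in> carrier G" "h \<in> carrier G" "x \<in> topspace N" for g h x
      using Q.flow_mult[OF N Q Q that(3), OF that(1,2)] rcos_sum[OF that(1,2)] by simp
  qed (use Q.flow_closed[OF N] Q in auto)
qed

lemma inflated_minimal_flow:
  assumes N: "minimal_flow (G Mod K) quotient_topology N actN"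
  shows "minimal_flow G T N (\<lambda>g. restrict (actN (K #> g)) (topspace N))"
proof -
  have "orbit G (\<lambda>g. restrict (actN (K #> g)) (topspace N)) x = orbit (G Mod K) actN x"
    if "x \<in> topspace N" for x
    using that by (auto simp: orbit_def carrier_FactGroup)
  then show ?thesis
    using N inflated_flow[of N actN] by (simp add: minimal_flow_def)
qed

context
  fixes M :: "'m topology" and act :: "'a \<Rightarrow> 'm \<Rightarrow> 'm" and F :: "'m \<Rightarrow> 'a"
  assumes M: "flow G T M act"
    and F: "continuous_map M (subtopology T K) F"
    and F_act: "\<And>k x. k \<in> K \<Longrightarrow> x \<in> topspace M \<Longrightarrow> F (act k x) = k \<otimes> F x"
begin

text \<open>
  As \<open>F(kx) = kF(x)\<close>, every \<open>K\<close>-orbit has exactly one point in the slice, and \<open>retract\<close> moves a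
  point to it.
\<close>
definition slice :: "'m set" where
  "slice = {x \<in> topspace M. F x = \<one>}"

definition retract :: "'m \<Rightarrow> 'm" where
  "retract x = act (inv (F x)) x"

text \<open>
  The action of \<open>G/K\<close> on the space of \<open>K\<close>-orbits, transferred to the slice. The representative of
  the coset does not matter because \<open>retract\<close> is constant on \<open>K\<close>-orbits.
\<close>
definition slice_action :: "'a set \<Rightarrow> 'm \<Rightarrow> 'm" where
  "slice_action A = restrict (\<lambda>c. retract (act (SOME g. g \<in> A) c)) slice"

lemma F_in_K: "x \<in> topspace M \<Longrightarrow> F x \<in> K"
  using F by (auto simp: continuous_map_in_subtopology)

lemma slice_closed: "closedin M slice"
proof -
  have "closedin M {x \<in> topspace M. F x \<in> {\<one>}}"
    using F Hausdorff
    by (intro closedin_continuous_map_preimage[of M T F])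
      (auto simp: continuous_map_in_subtopology topspace_eq intro: closedin_Hausdorff_singleton)
  then show ?thesis by (simp add: slice_def)
qed

lemma topspace_slice: "topspace (subtopology M slice) = slice"
  by (auto simp: slice_def)

lemma retract_in_slice:
  assumes x: "x \<in> topspace M"
  shows "retract x \<in> slice"
  using F_act[of "inv (F x)" x] x F_in_K[OF x] flow_closed[OF M]
  by (simp add: slice_def retract_def)

lemma retract_slice: "c \<in> slice \<Longrightarrow> retract c = c"
  using flow_one[OF M] by (simp add: slice_def retract_def)

lemma retract_continuous: "continuous_map M (subtopology M slice) retract"
proof -
  have "continuous_map M T F" using F by (simp add: continuous_map_in_subtopology)
  then have "continuous_map M M retract"
    unfolding retract_def
    by (intro flow_continuous_pair[OF M] continuous_map_inverse) simp_all
  then show ?thesis using retract_in_slice by (simp add: continuous_map_in_subtopology)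
qed

lemma retract_act_K:
  assumes k: "k \<in> K" and x: "x \<in> topspace M"
  shows "retract (act k x) = retract x"
proof -
  have kF: "k \<in> carrier G" "F x \<in> carrier G" using k F_in_K[OF x] by auto
  then have "retract (act k x) = act (inv (k \<otimes> F x) \<otimes> k) x"
    using k x by (simp add: retract_def F_act flow_mult[OF M])
  also have "inv (k \<otimes> F x) \<otimes> k = inv (F x)"
    using kF by (simp add: inv_mult_group m_assoc)
  finally show ?thesis by (simp add: retract_def)
qed

lemma retract_act_coset:
  assumes g: "g \<in> carrier G" and g': "g' \<in> K #> g" and x: "x \<in> topspace M"
  shows "retract (act g' x) = retract (act g x)"
proof -
  obtain k where k: "k \<in> K" "g' = k \<otimes> g" using g' by (auto simp: r_coset_def)
  then show ?thesis using retract_act_K[of k "act g x"] g x by (simp add: flow_mult[OF M] flow_closed[OF M])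
qed

text \<open>
  By normality, \<open>g\<close> maps \<open>K\<close>-orbits to \<open>K\<close>-orbits.
\<close>
lemma retract_act_retract:
  assumes g: "g \<in> carrier G" and x: "x \<in> topspace M"
  shows "retract (act g (retract x)) = retract (act g x)"
proof -
  have k: "F x \<in> K" by (rule F_in_K[OF x])
  have "act g (retract x) = act (g \<otimes> inv (F x)) x"
    using g x k by (simp add: retract_def flow_mult[OF M])
  moreover have "g \<otimes> inv (F x) \<in> K #> g"
  proof -
    have "g \<otimes> inv (F x) \<otimes> inv g \<in> K" using g k by (simp add: inv_op_closed2)
    moreover have "g \<otimes> inv (F x) = (g \<otimes> inv (F x) \<otimes> inv g) \<otimes> g"
      using g k by (simp add: m_assoc)
    ultimately show ?thesis unfolding r_coset_def by blast
  qed
  ultimately show ?thesis using retract_act_coset[OF g _ x] by simp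
qed

lemma slice_action_coset:
  assumes g: "g \<in> carrier G" and c: "c \<in> slice"
  shows "slice_action (K #> g) c = retract (act g c)"
proof -
  have "(SOME h. h \<in> K #> g) \<in> K #> g"
    using rcos_self[OF g is_subgroup] by (rule someI)
  then show ?thesis
    using retract_act_coset[OF g] c by (simp add: slice_action_def slice_def)
qed

lemma slice_flow: "flow (G Mod K) quotient_topology (subtopology M slice) slice_action"
proof -
  interpret Q: topologized_group "G Mod K" quotient_topology by (rule quotient_topologized_group)
  let ?C = "subtopology M slice"
  have sub: "c \<in> topspace M" if "c \<in> slice" for c using that by (simp add: slice_def)
  have closed: "slice_action (K #> g) c \<in> slice" if "g \<in> carrier G" "c \<in> slice" for g c
    using that sub by (simp add: slice_action_coset retract_in_slice flow_closed[OF M])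
  have "flow (G Mod K) quotient_topology ?C (\<lambda>A. restrict (slice_action A) (topspace ?C))"
  proof (rule Q.flowI)
    show "compact_space ?C"
      using slice_closed flow_compact[OF M] by (simp add: closedin_compact_space compact_space_subtopology)
    show "Hausdorff_space ?C" using flow_Hausdorff[OF M] by (rule Hausdorff_space_subtopology)
    have "slice_action (K #> g) \<in> slice \<rightarrow> slice" if "g \<in> carrier G" for g
      using closed that by auto
    then show "slice_action A c \<in> topspace ?C" if "A \<in> carrier (G Mod K)" "c \<in> topspace ?C" for A c
      using that unfolding topspace_slice by (auto simp: carrier_FactGroup)
    show "slice_action \<one>\<^bsub>G Mod K\<^esub> c = c" if "c \<in> topspace ?C" for c
      using that slice_action_coset[of \<one> c] flow_one[OF M] sub retract_slice
      unfolding topspace_slice by (simp add: coset_mult_one[OF subset])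
    show "slice_action (A \<otimes>\<^bsub>G Mod K\<^esub> B) c = slice_action A (slice_action B c)"
      if AB: "A \<in> carrier (G Mod K)" "B \<in> carrier (G Mod K)" and "c \<in> topspace ?C" for A B c
    proof -
      have c: "c \<in> slice" using \<open>c \<in> topspace ?C\<close> unfolding topspace_slice .
      obtain g h where gh: "A = K #> g" "B = K #> h" "g \<in> carrier G" "h \<in> carrier G"
        using AB by (auto simp: carrier_FactGroup)
      have "slice_action A (slice_action B c) = retract (act g (retract (act h c)))"
        using gh c closed[of h c] by (simp add: slice_action_coset)
      also have "\<dots> = retract (act (g \<otimes> h) c)"
        using gh sub[OF c] by (simp add: retract_act_retract flow_closed[OF M] flow_mult[OF M])
      finally show ?thesis using gh c by (simp add: rcos_sum slice_action_coset)
    qed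
    show "continuous_map (prod_topology quotient_topology ?C) ?C (\<lambda>(A, c). slice_action A c)"
    proof (rule pasting_lemma[where I = "carrier (G Mod K)" and T = "\<lambda>A. {A} \<times> slice"
          and f = "\<lambda>A z. slice_action A (snd z)"])
      fix A assume A: "A \<in> carrier (G Mod K)"
      then show "openin (prod_topology quotient_topology ?C) ({A} \<times> slice)"
        using openin_topspace[of ?C] unfolding topspace_slice by (simp add: openin_prod_Times_iff)
      obtain g where g: "g \<in> carrier G" "A = K #> g" using A by (auto simp: carrier_FactGroup)
      have "continuous_map ?C M (act g)"
        by (intro continuous_map_from_subtopology flow_continuous_act[OF M g(1)])
      from continuous_map_compose[OF this retract_continuous]
      have "continuous_map ?C ?C (slice_action A)"
        by (rule continuous_map_eq) (simp add: topspace_slice[simplified] g slice_action_coset)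
      from continuous_map_compose[OF continuous_map_snd this]
      show "continuous_map (subtopology (prod_topology quotient_topology ?C) ({A} \<times> slice)) ?C
          (\<lambda>z. slice_action A (snd z))"
        by (intro continuous_map_from_subtopology) (simp add: comp_def)
    qed auto
  qed
  moreover have "restrict (slice_action A) (topspace ?C) = slice_action A" for A
    unfolding topspace_slice by (simp add: slice_action_def)
  ultimately show ?thesis by simp
qed

text \<open>
  The preimage under \<open>retract\<close> of an invariant closed subset of the slice is one of \<open>M\<close>.
\<close>
lemma slice_minimal_flow:
  assumes min: "minimal_flow G T M act"
  shows "minimal_flow (G Mod K) quotient_topology (subtopology M slice) slice_action"
proof -
  interpret Q: topologized_group "G Mod K" quotient_topology by (rule quotient_topologized_group)
  let ?C = "subtopology M slice"
  have "A = slice" if A: "closedin ?C A" "Q.invariant slice_action A" "A \<noteq> {}" for A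
  proof -
    have A_slice: "A \<subseteq> slice" using closedin_subset[OF A(1)] unfolding topspace_slice .
    let ?B = "{x \<in> topspace M. retract x \<in> A}"
    have "closedin M ?B" by (rule closedin_continuous_map_preimage[OF retract_continuous A(1)])
    moreover have "invariant act ?B"
      unfolding invariant_def
    proof (intro ballI CollectI conjI)
      fix g x assume g: "g \<in> carrier G" and x: "x \<in> ?B"
      then have xM: "x \<in> topspace M" and rx: "retract x \<in> A" by auto
      show "act g x \<in> topspace M" by (rule flow_closed[OF M g xM])
      have "retract (act g x) = slice_action (K #> g) (retract x)"
        using g xM by (simp add: slice_action_coset retract_in_slice retract_act_retract)
      then show "retract (act g x) \<in> A"
        using A(2) g rx by (auto simp: Q.invariant_def carrier_FactGroup)
    qed
    moreover have "?B \<noteq> {}"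
      using A(3) A_slice retract_slice by (force simp: slice_def)
    ultimately have B: "?B = topspace M" using min unfolding minimal_flow_iff by blast
    have "c \<in> A" if c: "c \<in> slice" for c
    proof -
      have "c \<in> ?B" unfolding B using c by (simp add: slice_def)
      then show ?thesis using retract_slice[OF c] by simp
    qed
    then show ?thesis using A_slice by blast
  qed
  moreover have "slice \<noteq> {}"
    using min retract_in_slice unfolding minimal_flow_def by blast
  ultimately show ?thesis
    using slice_flow unfolding Q.minimal_flow_iff topspace_slice by blast
qed

text \<open>
  A homomorphism to a flow on which \<open>K\<close> acts trivially is constant on \<open>K\<close>-orbits, hence does
  not notice \<open>retract\<close>.
\<close>
lemma flow_hom_restrict_slice:
  assumes N: "flow (G Mod K) quotient_topology N actN"
    and \<phi>: "flow_hom G M act N (\<lambda>g. restrict (actN (K #> g)) (topspace N)) \<phi>"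
  shows "flow_hom (G Mod K) (subtopology M slice) slice_action N actN \<phi>"
  unfolding flow_hom_def
proof (intro conjI ballI)
  interpret Q: topologized_group "G Mod K" quotient_topology by (rule quotient_topologized_group)
  have cont: "continuous_map M N \<phi>" using \<phi> by (simp add: flow_hom_def)
  then show "continuous_map (subtopology M slice) N \<phi>" by (rule continuous_map_from_subtopology)
  have \<phi>N: "\<phi> x \<in> topspace N" if "x \<in> topspace M" for x
    using continuous_map_image_subset_topspace[OF cont] that by blast
  have \<phi>_act: "\<phi> (act g x) = actN (K #> g) (\<phi> x)" if "g \<in> carrier G" "x \<in> topspace M" for g x
    using \<phi> \<phi>N that by (simp add: flow_hom_def)
  have \<phi>_retract: "\<phi> (retract x) = \<phi> x" if x: "x \<in> topspace M" for x
  proof -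
    have "K #> inv (F x) = K"
      using F_in_K[OF x] is_subgroup by (intro coset_join2) auto
    then show ?thesis
      using \<phi>_act[of "inv (F x)" x] F_in_K[OF x] x Q.flow_one[OF N \<phi>N[OF x]]
      by (simp add: retract_def)
  qed
  fix A c assume A: "A \<in> carrier (G Mod K)" and "c \<in> topspace (subtopology M slice)"
  then have c: "c \<in> slice" "c \<in> topspace M" by auto
  obtain g where g: "g \<in> carrier G" "A = K #> g" using A by (auto simp: carrier_FactGroup)
  show "\<phi> (slice_action A c) = actN A (\<phi> c)"
    using c g by (simp add: slice_action_coset \<phi>_retract \<phi>_act flow_closed[OF M])
qed

text \<open>
  A point \<open>x\<close> is recovered as \<open>F(x)\<close> applied to its retraction, so \<open>x \<mapsto> (retract x, F x)\<close> is the
  inverse; compactness makes it continuous.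
\<close>
lemma slice_times_K_homeomorphic:
  "homeomorphic_map (prod_topology (subtopology M slice) (subtopology T K)) M (\<lambda>(c, k). act k c)"
proof (rule continuous_imp_homeomorphic_map)
  let ?C = "subtopology M slice" and ?K = "subtopology T K"
  have top: "topspace (prod_topology ?C ?K) = slice \<times> K"
    unfolding topspace_prod_topology topspace_slice by (simp add: topspace_Int_K)
  show "compact_space (prod_topology ?C ?K)"
    using compact slice_closed flow_compact[OF M]
    by (simp add: compact_space_prod_topology compact_space_subtopology closedin_compact_space)
  show "Hausdorff_space M" by (rule flow_Hausdorff[OF M])
  have "continuous_map (prod_topology ?C ?K) M (\<lambda>z. act (snd z) (fst z))"
    using continuous_map_fst[of ?C ?K] continuous_map_snd[of ?C ?K]
    by (intro flow_continuous_pair[OF M]) (simp_all add: continuous_map_in_subtopology)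
  then show cont: "continuous_map (prod_topology ?C ?K) M (\<lambda>(c, k). act k c)"
    by (simp add: case_prod_unfold)
  have sub: "c \<in> topspace M" "F c = \<one>" if "c \<in> slice" for c using that by (simp_all add: slice_def)
  show "(\<lambda>(c, k). act k c) ` topspace (prod_topology ?C ?K) = topspace M"
  proof (intro equalityI subsetI)
    fix x assume x: "x \<in> topspace M"
    have "act (F x) (retract x) = x"
      using F_in_K[OF x] x flow_mult[OF M, of "F x" "inv (F x)" x] flow_one[OF M x]
      by (simp add: retract_def)
    then have "x = (\<lambda>(c, k). act k c) (retract x, F x)" by simp
    then show "x \<in> (\<lambda>(c, k). act k c) ` topspace (prod_topology ?C ?K)"
      unfolding top using retract_in_slice[OF x] F_in_K[OF x] by blast
  qed (use sub flow_closed[OF M] in \<open>auto simp: top\<close>)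
  show "inj_on (\<lambda>(c, k). act k c) (topspace (prod_topology ?C ?K))"
    unfolding top
  proof (rule inj_onI, clarify)
    fix c k d l assume c: "c \<in> slice" "k \<in> K" "d \<in> slice" "l \<in> K" "act k c = act l d"
    have F_eq: "F (act k c) = k" if "c \<in> slice" "k \<in> K" for c k
      using that sub by (simp add: F_act)
    have retract_eq: "retract (act k c) = c" if "c \<in> slice" "k \<in> K" for c k
      using that sub by (simp add: retract_act_K retract_slice)
    show "c = d \<and> k = l"
      using c(5) F_eq[OF c(1,2)] F_eq[OF c(3,4)] retract_eq[OF c(1,2)] retract_eq[OF c(3,4)] by simp
  qed
qed

end

theorem universal_minimal_flow_product:
  assumes M: "universal_minimal_flow G T M actM"
    and N: "universal_minimal_flow (G Mod K) quotient_topology N actN"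
  shows "\<exists>act. flow G T (prod_topology N (subtopology T K)) act \<and>
    (\<exists>f. flow_iso G M actM (prod_topology N (subtopology T K)) act f)"
proof -
  interpret Q: topologized_group "G Mod K" quotient_topology by (rule quotient_topologized_group)
  let ?K = "subtopology T K"
  have minM: "minimal_flow G T M actM" and minN: "minimal_flow (G Mod K) quotient_topology N actN"
    using M N by (simp_all add: universal_minimal_flow_def)
  then have flowM: "flow G T M actM" and flowN: "flow (G Mod K) quotient_topology N actN"
    by (simp_all add: minimal_flow_def)
  obtain F where F: "continuous_map M ?K F"
    "\<And>k x. k \<in> K \<Longrightarrow> x \<in> topspace M \<Longrightarrow> F (actM k x) = k \<otimes> F x"
    using equivariant_map_to_K[OF M] by blast
  let ?C = "subtopology M (slice M F)" and ?actC = "slice_action M actM F"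
  have minC: "minimal_flow (G Mod K) quotient_topology ?C ?actC"
    using flowM F minM by (rule slice_minimal_flow)
  obtain \<phi> where "flow_hom G M actM N (\<lambda>g. restrict (actN (K #> g)) (topspace N)) \<phi>"
    using universal_minimal_flow_hom[OF M inflated_minimal_flow[OF minN]] by blast
  with flowM F flowN have "flow_hom (G Mod K) ?C ?actC N actN \<phi>"
    by (rule flow_hom_restrict_slice)
  then obtain f where f: "flow_iso (G Mod K) N actN ?C ?actC f"
    using Q.minimal_flow_over_universal_iso[OF N minC] by blast
  have "homeomorphic_map N ?C f"
    using f Q.flow_compact[OF flowN] flow_Hausdorff[OF flowM]
    by (intro continuous_imp_homeomorphic_map Hausdorff_space_subtopology)
      (auto simp: flow_iso_def flow_hom_def bij_betw_def)
  then obtain f' where f': "homeomorphic_maps N ?C f f'" by (auto simp: homeomorphic_map_maps)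
  obtain \<theta> where \<theta>: "homeomorphic_maps (prod_topology ?C ?K) M (\<lambda>(c, k). actM k c) \<theta>"
    using slice_times_K_homeomorphic[OF flowM F] by (auto simp: homeomorphic_map_maps)
  have "homeomorphic_maps (prod_topology N ?K) (prod_topology ?C ?K)
      (\<lambda>(x, k). (f x, id k)) (\<lambda>(c, k). (f' c, id k))"
    unfolding homeomorphic_maps_prod using f' homeomorphic_maps_id[of ?K ?K] by blast
  from homeomorphic_maps_compose[OF conjI[OF this \<theta>]]
  obtain h h' where h: "homeomorphic_maps M (prod_topology N ?K) h h'"
    unfolding homeomorphic_maps_sym[of _ M] by blast
  have "bij_betw h (topspace M) (topspace (prod_topology N ?K))"
    using homeomorphic_maps_imp_map[OF h]
    by (simp add: bij_betw_def homeomorphic_imp_injective_map homeomorphic_imp_surjective_map)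
  then show ?thesis
    using flow_transport[OF flowM h] unfolding flow_iso_def by blast
qed

end

theorem theorem8:
  fixes G :: "('g, 'b) monoid_scheme" and T :: "'g topology" and K :: "'g set"
    and M :: "'m topology" and actM :: "'g \<Rightarrow> 'm \<Rightarrow> 'm"
    and N :: "'n topology" and actN :: "'g set \<Rightarrow> 'n \<Rightarrow> 'n"
  assumes "topological_group G T"
    and "SIN G T"
    and "totally_disconnected_space T"
    and "locally_compact_space T"
    and "K \<lhd> G" and "compactin T K" and "openin T K"
    and "universal_minimal_flow G T M actM"
    and "universal_minimal_flow (G Mod K) (discrete_topology (carrier (G Mod K))) N actN"
  shows "\<exists>act. flow G T (prod_topology N (subtopology T K)) act \<and>
           (\<exists>f. flow_iso G M actM (prod_topology N (subtopology T K)) act f)"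
proof -
  have "Hausdorff_space T"
    using topological_group.totally_disconnected_imp_Hausdorff assms(1,3) .
  then interpret compact_open_normal_subgroup G T K
    using assms by (intro compact_open_normal_subgroup.intro compact_open_normal_subgroup_axioms.intro)
  show ?thesis using assms(8,9) by (rule universal_minimal_flow_product)
qed

end
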